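(* Let $0<q<1$ and let $a,b,c$ satisfy $|a|,|b|,|c|<1$. Let $T_{a,c}$ be the linear transformation on polynomials in $x$ with $$T_{a,c}(x^k)=\frac{(ae^{i\theta},ae^{-i\theta};q)_k}{(ac;q)_k},\qquad k=0,1,2,\dots,\quad x=\cos\theta.$$ Then for every integer $n\ge0$ the continuous dual $q$-Hahn polynomials $p_n(x;a,b,c|q)$ and the little $q$-Laguerre polynomials $q_n(x;\cdot|q)$ are connected by $$p_n(x;a,b,c|q)=T_{a,c}\,q_n(x;ab/q|q).$$
   Context: Notation: $(z;q)_k=\prod_{j=0}^{k-1}(1-zq^j)$, $(z_1,\dots,z_m;q)_k=\prod_i(z_i;q)_k$. For $x=\cos\theta$, $(ae^{i\theta},ae^{-i\theta};q)_k=\prod_{j=0}^{k-1}(1+a^2q^{2j}-2aq^jx)$ is a polynomial in $x$. Continuous dual $q$-Hahn polynomials: $$p_n(x;a,b,c|q)={}_3\phi_2\left(\left.\begin{array}{c}q^{-n},ae^{i\theta},ae^{-i\theta}\\ ab,ac\end{array}\right|q,q\right)=\sum_{k=0}^n\frac{(q^{-n},ae^{i\theta},ae^{-i\theta};q)_k}{(ab,ac,q;q)_k}q^k,\quad x=\cos\theta$$ (they are orthogonal on $[-1,1]$ with respect to $\frac{(e^{2i\theta},e^{-2i\theta};q)_\infty}{(ae^{i\theta},ae^{-i\theta},be^{i\theta},be^{-i\theta},ce^{i\theta},ce^{-i\theta};q)_\infty}\frac{dx}{\sqrt{1-x^2}}$). Little $q$-Laguerre polynomials: $$q_n(x;a|q)={}_2\phi_1\left(\left.\begin{array}{c}q^{-n},0\\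 aq\end{array}\right|q,qx\right)=\sum_{k=0}^n\frac{(q^{-n};q)_k}{(aq;q)_k(q;q)_k}(qx)^k .$$ *)

theory Defs
  imports "HOL-Analysis.Complex_Transcendental" "HOL-Computational_Algebra.Polynomial"
begin

definition qpoch :: "'a::comm_ring_1 \<Rightarrow> 'a \<Rightarrow> nat \<Rightarrow> 'a" where
  "qpoch z q k = (\<Prod>j<k. 1 - z * q ^ j)"

text \<open>The product \<open>(a e\<^sup>i\<^sup>\<theta>, a e\<^sup>-\<^sup>i\<^sup>\<theta>; q)\<^sub>k\<close> as a polynomial in \<open>x = cos \<theta>\<close>; see
  \<open>poly_qpoch_pair_cos\<close> below.\<close>

definition qpoch_pair :: "complex \<Rightarrow> complex \<Rightarrow> nat \<Rightarrow> complex poly" where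
  "qpoch_pair a q k = (\<Prod>j<k. [:1 + a\<^sup>2 * q ^ (2 * j), - 2 * a * q ^ j:])"

definition cont_dual_q_Hahn ::
    "nat \<Rightarrow> complex \<Rightarrow> complex \<Rightarrow> complex \<Rightarrow> complex \<Rightarrow> complex poly" where
  "cont_dual_q_Hahn n a b c q =
     (\<Sum>k\<le>n. smult (qpoch (q powi (- int n)) q k /
                     (qpoch (a * b) q k * qpoch (a * c) q k * qpoch q q k) * q ^ k)
                (qpoch_pair a q k))"

definition little_q_Laguerre :: "nat \<Rightarrow> complex \<Rightarrow> complex \<Rightarrow> complex poly" where
  "little_q_Laguerre n a q =
     (\<Sum>k\<le>n. smult (qpoch (q powi (- int n)) q k / (qpoch (a * q) q k * qpoch q q k))
                ([:0, q:] ^ k))"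

lemma poly_qpoch_pair_cos:
  fixes a q \<theta> :: complex
  shows "poly (qpoch_pair a q k) (cos \<theta>) =
    qpoch (a * exp (\<i> * \<theta>)) q k * qpoch (a * exp (- (\<i> * \<theta>))) q k"
proof -
  have e: "exp (\<i> * \<theta>) * exp (- (\<i> * \<theta>)) = 1"
    by (simp flip: exp_add)
  have "1 + a\<^sup>2 * q ^ (2 * j) - cos \<theta> * (2 * a * q ^ j) =
      (1 - a * exp (\<i> * \<theta>) * q ^ j) * (1 - a * exp (- (\<i> * \<theta>)) * q ^ j)" for j
  proof -
    have "(1 - a * exp (\<i> * \<theta>) * q ^ j) * (1 - a * exp (- (\<i> * \<theta>)) * q ^ j) =
      1 + a\<^sup>2 * q ^ (2 * j) * (exp (\<i> * \<theta>) * exp (- (\<i> * \<theta>)))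
        - (exp (\<i> * \<theta>) + exp (- (\<i> * \<theta>))) * (a * q ^ j)"
      by (simp add: algebra_simps power2_eq_square mult_2 mult_2_right power_add)
    also have "\<dots> = 1 + a\<^sup>2 * q ^ (2 * j) - (2 * cos \<theta>) * (a * q ^ j)"
      by (simp add: e cos_exp_eq)
    finally show ?thesis by (simp add: algebra_simps)
  qed
  then show ?thesis
    by (simp add: qpoch_pair_def qpoch_def poly_prod prod.distrib)
qed

lemma poly_cont_dual_q_Hahn_cos:
  fixes a b c q \<theta> :: complex
  shows "poly (cont_dual_q_Hahn n a b c q) (cos \<theta>) =
    (\<Sum>k\<le>n. qpoch (q powi (- int n)) q k * qpoch (a * exp (\<i> * \<theta>)) q k *
        qpoch (a * exp (- (\<i> * \<theta>))) q k /
        (qpoch (a * b) q k * qpoch (a * c) q k * qpoch q q k) * q ^ k)"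
  by (simp add: cont_dual_q_Hahn_def poly_sum poly_qpoch_pair_cos mult_ac)

lemma poly_little_q_Laguerre:
  "poly (little_q_Laguerre n a q) x =
    (\<Sum>k\<le>n. qpoch (q powi (- int n)) q k / (qpoch (a * q) q k * qpoch q q k) * (q * x) ^ k)"
  by (simp add: little_q_Laguerre_def poly_sum mult_ac)

text \<open>The transformation \<open>T\<^sub>a\<^sub>,\<^sub>c\<close> exists and is determined by its values on monomials.\<close>

lemma ex1_T:
  fixes a c q :: complex
  shows "\<exists>!T. Vector_Spaces.linear smult smult T \<and>
     (\<forall>k. T (monom 1 k) = smult (1 / qpoch (a * c) q k) (qpoch_pair a q k))"
    (is "\<exists>!T. ?is_T T")
proof -
  define B where "B k = smult (1 / qpoch (a * c) q k) (qpoch_pair a q k)" for k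
  define T where "T p = (\<Sum>k\<le>degree p. smult (coeff p k) (B k))" for p
  have T_eq: "T p = (\<Sum>k\<le>N. smult (coeff p k) (B k))" if "degree p \<le> N" for p N
    unfolding T_def by (rule sum.mono_neutral_left) (use that in \<open>auto simp: coeff_eq_0\<close>)
  have add: "T (p + r) = T p + T r" for p r
  proof -
    let ?N = "max (degree p) (degree r)"
    have "degree (p + r) \<le> ?N" by (rule degree_add_le_max)
    then show ?thesis
      by (simp add: T_eq[of _ ?N] smult_add_left sum.distrib)
  qed
  have smult_sum_right: "smult s (sum f A) = (\<Sum>i\<in>A. smult s (f i))"
    for s :: complex and f :: "nat \<Rightarrow> complex poly" and A
    by (induction A rule: infinite_finite_induct) (auto simp: smult_add_right)
  have smult: "T (smult s p) = smult s (T p)" for s p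
    by (simp add: T_eq[of "smult s p" "degree p"] T_eq[of p "degree p"] smult_sum_right)
  have monom: "T (monom 1 k) = B k" for k
  proof -
    have "T (monom 1 k) = (\<Sum>i\<le>k. if i = k then B k else 0)"
      unfolding T_eq[OF degree_monom_le] by (intro sum.cong) auto
    then show ?thesis by simp
  qed
  have "?is_T T"
    unfolding Vector_Spaces.linear_def module_hom_def module_hom_axioms_def
    by (auto simp: add smult monom B_def vector_space_def module_def smult_add_right smult_add_left)
  moreover have "S = T" if "?is_T S" for S
  proof
    fix p
    interpret S: Vector_Spaces.linear smult smult S
      using that by blast
    have "S p = S (\<Sum>k\<le>degree p. smult (coeff p k) (monom 1 k))"
      by (simp add: smult_monom poly_as_sum_of_monoms)
    also have "\<dots> = T p"
      using that by (simp add: S.sum S.scale T_def B_def)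
    finally show "S p = T p" .
  qed
  ultimately show ?thesis by blast
qed

end

theory Submission imports Defs begin

text \<open>
  Each \<open>T (x\<^sup>k)\<close> carries exactly the two factors, \<open>(a e\<^sup>i\<^sup>\<theta>, a e\<^sup>-\<^sup>i\<^sup>\<theta>; q)\<^sub>k\<close> above
  and \<open>(a c; q)\<^sub>k\<close> below, by which the \<open>k\<close>-th term of the \<open>\<^sub>3\<phi>\<^sub>2\<close> series differs from that of the
  \<open>\<^sub>2\<phi>\<^sub>1\<close> series with parameter \<open>a b / q\<close>. By linearity \<open>T\<close> acts on the terminating
  \<open>\<^sub>2\<phi>\<^sub>1\<close> series term by term, and each summand \<open>x\<^sup>k\<close> turns into the matching summand in \<open>cos \<theta>\<close>.
\<close>

theorem theorem2p7:
  fixes q :: real and a b c :: complex and n :: nat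
    and T :: "complex poly \<Rightarrow> complex poly"
  assumes "0 < q" and "q < 1"
    and "norm a < 1" and "norm b < 1" and "norm c < 1"
    and "Vector_Spaces.linear smult smult T"
    and "\<And>k. T (monom 1 k) =
           smult (1 / qpoch (a * c) (of_real q) k) (qpoch_pair a (of_real q) k)"
  shows "cont_dual_q_Hahn n a b c (of_real q) =
           T (little_q_Laguerre n (a * b / of_real q) (of_real q))"
proof -
  interpret T: Vector_Spaces.linear smult smult T by fact
  have shift: "a * b / of_real q * of_real q = a * b"
    using \<open>0 < q\<close> by simp
  have qx_power: "[:0, of_real q:] ^ k = smult (of_real q ^ k) (monom (1::complex) k)" for k
    by (simp add: smult_monom monom_power flip: monom_0 monom_Suc)
  show ?thesis
    unfolding cont_dual_q_Hahn_def little_q_Laguerre_def shift qx_power T.sum T.scale assms(7)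
    by (simp add: mult_ac)
qed

end
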